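(* Let $G$ be a graph on $n\ge 2$ vertices, and let $S\subseteq V(G)$ (nonempty, $S\ne V(G)$) induce a sparsest cut in $G$. Let $x\in\mathbb{R}^{V(G)}$ be the associated $\ell_1$-Fiedler vector, given by $x_v=\frac{1}{2|S|}$ if $v\in S$ and $x_v=-\frac{1}{2|S^c|}$ if $v\in S^c$. Then (i) $\sum_{u\in S}(L(G)x)_u=b(G)$, (ii) $\sum_{u\in S^c}(L(G)x)_u=-b(G)$, where $L(G)$ is the Laplacian matrix of $G$.
   Context: Graphs are finite, simple, undirected and unweighted. For a graph $G$ with vertex set $V(G)$, $|V(G)|=n\ge 2$, and edge set $E(G)$, the $\ell_1$-Fiedler value is $$b(G)=\min\Big\{\sum_{uv\in E(G)}|x_u-x_v| : x\in\mathbb{R}^{V(G)},\ \sum_{v\in V(G)}x_v=0,\ \sum_{v\in V(G)}|x_v|=1\Big\}.$$ For nonempty $S\subsetneq V(G)$, $S^c=V(G)\setminus S$, the cut induced by $S$ is $\partial S=\{uv\in E(G):u\in S,\ v\in S^c\}$, and its edge density (sparsity) is $\rho(S)=\frac{|\partial S|}{|S||S^c|}$. The set $S$ induces a sparsest cut if it minimizes $\rho$ over all nonempty proper subsets of $V(G)$. The Laplacian is $L(G)=\Delta(G)-A(G)$, where $\Delta(G)$ is the diagonal matrix of vertex degrees and $A(G)$ is the adjacency matrix. *)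

theory Defs
  imports "HOL-Analysis.Analysis"
begin

text \<open>
  A graph \<open>G\<close> with \<open>V(G) = UNIV :: 'v::finite set\<close> is given by its set of edges, each of which
  is a two-element set of vertices (no loops, no parallel edges, no orientation).
\<close>

definition simple_graph :: "'v set set \<Rightarrow> bool" where
  "simple_graph E \<longleftrightarrow> (\<forall>e\<in>E. card e = 2)"

text \<open>The value \<open>\<bar>x\<^sub>u - x\<^sub>v\<bar>\<close> does not depend on how the edge \<open>uv\<close> is written as a pair.\<close>

definition edge_diff :: "real ^ 'v \<Rightarrow> 'v set \<Rightarrow> real" where
  "edge_diff x e = (THE d. \<exists>u v. e = {u, v} \<and> d = \<bar>x $ u - x $ v\<bar>)"

lemma edge_diff_pair: "edge_diff x {u, v} = \<bar>x $ u - x $ v\<bar>"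
  unfolding edge_diff_def
  by (rule the_equality) (auto simp: doubleton_eq_iff abs_minus_commute)

text \<open>A minimum, not just an infimum: \<open>LEAST\<close> determines \<open>b(G)\<close> only because the minimum is attained.\<close>

definition l1_fiedler_value :: "'v::finite set set \<Rightarrow> real" where
  "l1_fiedler_value E =
     (LEAST b. b \<in> {(\<Sum>e\<in>E. edge_diff x e) | x :: real ^ 'v.
                      (\<Sum>v\<in>UNIV. x $ v) = 0 \<and> (\<Sum>v\<in>UNIV. \<bar>x $ v\<bar>) = 1})"

definition cut :: "'v set set \<Rightarrow> 'v set \<Rightarrow> 'v set set" where
  "cut E S = {e \<in> E. \<exists>u\<in>S. \<exists>v\<in>- S. e = {u, v}}"

definition cut_density :: "'v::finite set set \<Rightarrow> 'v set \<Rightarrow> real" where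
  "cut_density E S = real (card (cut E S)) / (real (card S) * real (card (- S)))"

definition sparsest_cut :: "'v::finite set set \<Rightarrow> 'v set \<Rightarrow> bool" where
  "sparsest_cut E S \<longleftrightarrow> S \<noteq> {} \<and> S \<noteq> UNIV \<and>
     (\<forall>T. T \<noteq> {} \<and> T \<noteq> UNIV \<longrightarrow> cut_density E S \<le> cut_density E T)"

definition degree :: "'v set set \<Rightarrow> 'v \<Rightarrow> nat" where
  "degree E v = card {e \<in> E. v \<in> e}"

definition degree_matrix :: "'v::finite set set \<Rightarrow> real ^ 'v ^ 'v" where
  "degree_matrix E = (\<chi> u v. if u = v then real (degree E u) else 0)"

definition adjacency_matrix :: "'v::finite set set \<Rightarrow> real ^ 'v ^ 'v" where
  "adjacency_matrix E = (\<chi> u v. if {u, v} \<in> E then 1 else 0)"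

definition laplacian :: "'v::finite set set \<Rightarrow> real ^ 'v ^ 'v" where
  "laplacian E = degree_matrix E - adjacency_matrix E"

definition l1_fiedler_vector :: "'v::finite set \<Rightarrow> real ^ 'v" where
  "l1_fiedler_vector S =
     (\<chi> v. if v \<in> S then 1 / (2 * real (card S)) else - (1 / (2 * real (card (- S)))))"

end

theory Submission
  imports Defs
begin

text \<open>
  Every function on the vertices is a nonnegative combination of indicators of its superlevel sets,
  up to a constant, and \<open>\<bar>f u - f v\<bar>\<close> is additive along this combination. So with \<open>\<rho>\<close> the least cut
  density, \<open>\<Sum>\<^sub>u\<^sub>v\<^sub>\<in>\<^sub>E \<bar>x\<^sub>u - x\<^sub>v\<bar> \<ge> \<rho> \<Sum>\<^bsub>{u,v}\<^esub> \<bar>x\<^sub>u - x\<^sub>v\<bar>\<close>, the last sum being over all pairs of vertices. If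
  \<open>x\<close> has mean zero then \<open>\<Sum>\<^sub>v \<bar>x\<^sub>u - x\<^sub>v\<bar> \<ge> n \<bar>x\<^sub>u\<bar>\<close>, whence \<open>b(G) \<ge> n \<rho> / 2\<close>. The two-valued vector of a
  sparsest cut attains this bound, and the off-diagonal terms of its Laplacian cancel inside \<open>S\<close>,
  leaving the same quantity on the edges of the cut.
\<close>

section \<open>From cuts to arbitrary functions on the vertices\<close>

text \<open>The weights may be negative, so the sum cannot be bounded term by term. Instead,
  lowering the largest value of \<open>f\<close> to the second largest removes one value and changes
  the double sum by a nonnegative multiple of a cut sum; induction on the number of values ends at a
  constant function.\<close>

lemma cut_inequality_extends:
  fixes w :: "'v::finite \<Rightarrow> 'v \<Rightarrow> real" and f :: "'v \<Rightarrow> real"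
  assumes cuts: "\<And>T. 0 \<le> (\<Sum>u\<in>UNIV. \<Sum>v\<in>UNIV. w u v * \<bar>indicator T u - indicator T v\<bar>)"
  shows "0 \<le> (\<Sum>u\<in>UNIV. \<Sum>v\<in>UNIV. w u v * \<bar>f u - f v\<bar>)"
proof (induction "card (range f)" arbitrary: f rule: less_induct)
  case less
  define M where "M = Max (range f)"
  have f_le_M: "f v \<le> M" for v
    by (simp add: M_def)
  show ?case
  proof (cases "range f - {M} = {}")
    case True
    then have "f u = M" for u by auto
    then show ?thesis by simp
  next
    case False
    define m where "m = Max (range f - {M})"
    have m_in: "m \<in> range f - {M}"
      unfolding m_def using False by (intro Max_in) auto
    have f_le_m: "f v \<le> m" if "f v \<noteq> M" for v
      unfolding m_def using that by (intro Max_ge) auto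
    have "m < M"
      using m_in f_le_M by (auto simp: less_le)
    define g where "g = (\<lambda>v. min (f v) m)"
    have "range g \<subseteq> range f - {M}"
    proof
      fix y assume "y \<in> range g"
      then obtain v where v: "y = min (f v) m"
        by (auto simp: g_def)
      show "y \<in> range f - {M}"
        using v m_in \<open>m < M\<close> by (cases "f v \<le> m") (auto simp: min_def)
    qed
    also have "\<dots> \<subset> range f"
      using Max_in[of "range f"] by (auto simp: M_def)
    finally have "card (range g) < card (range f)"
      by (simp add: psubset_card_mono)
    then have IH: "0 \<le> (\<Sum>u\<in>UNIV. \<Sum>v\<in>UNIV. w u v * \<bar>g u - g v\<bar>)"
      by (rule less)
    define T where "T = {v. f v = M}"
    have f_eq: "f v = g v + (M - m) * indicator T v" for v
      using f_le_m[of v] \<open>m < M\<close> by (cases "f v = M") (auto simp: g_def T_def min_def)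
    have g_eq: "g v = m" if "v \<in> T" for v
      using that \<open>m < M\<close> by (auto simp: g_def T_def)
    have g_le: "g v \<le> m" for v
      by (simp add: g_def)
    \<comment> \<open>Additivity holds because \<open>g\<close> attains its maximum \<open>m\<close>
      on all of \<open>T\<close>: when \<open>u\<close> is in \<open>T\<close> and \<open>v\<close>
      is not, \<open>g u - g v\<close> and the added jump \<open>M - m\<close> are both nonnegative,
      so no cancellation occurs.\<close>
    have "\<bar>f u - f v\<bar> = \<bar>g u - g v\<bar> + (M - m) * \<bar>indicator T u - indicator T v\<bar>" for u v
      using g_le[of u] g_le[of v] g_eq[of u] g_eq[of v] \<open>m < M\<close>
      by (cases "u \<in> T"; cases "v \<in> T") (auto simp: f_eq)
    then have "(\<Sum>u\<in>UNIV. \<Sum>v\<in>UNIV. w u v * \<bar>f u - f v\<bar>) =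
        (\<Sum>u\<in>UNIV. \<Sum>v\<in>UNIV. w u v * \<bar>g u - g v\<bar>) +
        (M - m) * (\<Sum>u\<in>UNIV. \<Sum>v\<in>UNIV. w u v * \<bar>indicator T u - indicator T v\<bar>)"
      by (simp add: distrib_left sum.distrib sum_distrib_left mult.left_commute)
    then show ?thesis
      using IH cuts[of T] \<open>m < M\<close> by simp
  qed
qed

section \<open>Counting edges and cuts by pairs of vertices\<close>

lemma simple_graph_edgeE:
  assumes "simple_graph E" and "e \<in> E"
  obtains u v where "e = {u, v}" and "u \<noteq> v"
  using assms unfolding simple_graph_def card_2_iff by metis

text \<open>The fibre of ordered pairs over an edge \<open>{a, b}\<close> is
  \<open>{(a, b), (b, a)}\<close>, of size two because there are no loops.\<close>

lemma sum_adjacent_pairs: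
  fixes h :: "'v::finite set \<Rightarrow> real"
  assumes "simple_graph E"
  shows "(\<Sum>u\<in>UNIV. \<Sum>v\<in>UNIV. of_bool ({u, v} \<in> E) * h {u, v}) = 2 * (\<Sum>e\<in>E. h e)"
proof -
  let ?P = "{p :: 'v \<times> 'v. {fst p, snd p} \<in> E}"
  have fibre: "(\<Sum>p\<in>{p \<in> ?P. {fst p, snd p} = e}. h {fst p, snd p}) = 2 * h e" if "e \<in> E" for e
  proof -
    obtain a b where ab: "e = {a, b}" "a \<noteq> b"
      by (rule simple_graph_edgeE[OF assms \<open>e \<in> E\<close>])
    have "{u, v} = e \<longleftrightarrow> u = a \<and> v = b \<or> u = b \<and> v = a" for u v
      by (simp add: ab(1) doubleton_eq_iff)
    moreover have "{a, b} \<in> E" "{b, a} \<in> E"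
      using ab(1) \<open>e \<in> E\<close> by (simp_all add: insert_commute)
    ultimately have "{p \<in> ?P. {fst p, snd p} = e} = {(a, b), (b, a)}"
      by auto
    then show ?thesis
      using ab by (simp add: insert_commute)
  qed
  have "(\<Sum>u\<in>UNIV. \<Sum>v\<in>UNIV. of_bool ({u, v} \<in> E) * h {u, v}) =
      (\<Sum>p\<in>UNIV. of_bool (p \<in> ?P) * h {fst p, snd p})"
    unfolding sum.cartesian_product by (simp add: case_prod_unfold)
  also have "\<dots> = (\<Sum>p\<in>?P. h {fst p, snd p})"
    by (intro sum.mono_neutral_cong_right) auto
  also have "\<dots> = (\<Sum>e\<in>E. \<Sum>p\<in>{p \<in> ?P. {fst p, snd p} = e}. h {fst p, snd p})"
    by (intro sum.group[symmetric]) auto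
  also have "\<dots> = 2 * (\<Sum>e\<in>E. h e)"
    unfolding sum_distrib_left by (rule sum.cong[OF refl fibre])
  finally show ?thesis .
qed

lemma cut_Compl: "cut E (- S) = cut E S"
  by (auto simp: cut_def insert_commute)

lemma doubleton_mem_cut_iff:
  assumes "{u, v} \<in> E"
  shows "{u, v} \<in> cut E S \<longleftrightarrow> (u \<in> S \<longleftrightarrow> v \<notin> S)"
  using assms by (auto simp: cut_def doubleton_eq_iff)

text \<open>No factor 2 appears here: a cut edge has exactly one orientation leading from
  \<open>S\<close> to \<open>- S\<close>.\<close>

lemma card_cut_eq_sum:
  fixes E :: "'v::finite set set"
  shows "real (card (cut E S)) = (\<Sum>u\<in>S. \<Sum>v\<in>- S. of_bool ({u, v} \<in> E))"
proof -
  have "bij_betw (\<lambda>(u, v). {u, v}) {p \<in> S \<times> - S. {fst p, snd p} \<in> E} (cut E S)"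
    by (rule bij_betw_imageI) (auto simp: inj_on_def doubleton_eq_iff cut_def image_iff)
  then have "card (cut E S) = card {p \<in> S \<times> - S. {fst p, snd p} \<in> E}"
    by (simp add: bij_betw_same_card)
  also have "real \<dots> = (\<Sum>p\<in>S \<times> - S. of_bool ({fst p, snd p} \<in> E))"
    by (simp add: Collect_conj_eq)
  also have "\<dots> = (\<Sum>u\<in>S. \<Sum>v\<in>- S. of_bool ({u, v} \<in> E))"
    by (simp only: sum.cartesian_product case_prod_unfold)
  finally show ?thesis .
qed

text \<open>Only edges crossing the cut see both values. This serves the indicators of arbitrary
  cuts as well as the Fiedler vector.\<close>

lemma sum_edge_diff_two_valued:
  fixes E :: "'v::finite set set"
  assumes "simple_graph E"
  shows "(\<Sum>e\<in>E. edge_diff (\<chi> v. if v \<in> S then a else b) e) = \<bar>a - b\<bar> * real (card (cut E S))"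
proof -
  have "edge_diff (\<chi> v. if v \<in> S then a else b) e = \<bar>a - b\<bar> * of_bool (e \<in> cut E S)"
    if "e \<in> E" for e
  proof -
    obtain u v where "e = {u, v}"
      using simple_graph_edgeE[OF assms \<open>e \<in> E\<close>] by metis
    then show ?thesis
      using \<open>e \<in> E\<close> by (auto simp: edge_diff_pair doubleton_mem_cut_iff)
  qed
  then have "(\<Sum>e\<in>E. edge_diff (\<chi> v. if v \<in> S then a else b) e) =
      \<bar>a - b\<bar> * (\<Sum>e\<in>E. of_bool (e \<in> cut E S))"
    by (simp add: sum_distrib_left)
  moreover have "cut E S \<subseteq> E"
    by (auto simp: cut_def)
  then have "(\<Sum>e\<in>E. of_bool (e \<in> cut E S) :: real) = real (card (cut E S))"
    by (simp add: Int_absorb1)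
  ultimately show ?thesis
    by simp
qed

section \<open>The value of \<open>b(G)\<close>\<close>

text \<open>The extension of cut inequalities is applied to the weight
  \<open>of_bool ({u, v} \<in> E) - cut_density E S\<close>; its nonnegativity on indicators is the
  minimality of the density of \<open>S\<close>.\<close>

lemma sum_edge_diff_ge_density:
  fixes E :: "'v::finite set set" and x :: "real ^ 'v"
  assumes "simple_graph E" and "sparsest_cut E S"
  shows "cut_density E S * (\<Sum>u\<in>UNIV. \<Sum>v\<in>UNIV. \<bar>x $ u - x $ v\<bar>) \<le> 2 * (\<Sum>e\<in>E. edge_diff x e)"
proof -
  let ?\<rho> = "cut_density E S"
  have split: "(\<Sum>u\<in>UNIV. \<Sum>v\<in>UNIV. (of_bool ({u, v} \<in> E) - ?\<rho>) * \<bar>y $ u - y $ v\<bar>) =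
      2 * (\<Sum>e\<in>E. edge_diff y e) - ?\<rho> * (\<Sum>u\<in>UNIV. \<Sum>v\<in>UNIV. \<bar>y $ u - y $ v\<bar>)" for y
    using sum_adjacent_pairs[OF assms(1), of "edge_diff y"]
    by (simp add: edge_diff_pair left_diff_distrib sum_subtractf sum_distrib_left)
  have "0 \<le> (\<Sum>u\<in>UNIV. \<Sum>v\<in>UNIV.
      (of_bool ({u, v} \<in> E) - ?\<rho>) * \<bar>indicator T u - indicator T v\<bar>)" for T
  proof -
    define y :: "real ^ 'v" where "y = (\<chi> v. if v \<in> T then 1 else 0)"
    have y_nth: "y $ v = indicator T v" for v
      by (simp add: y_def)
    have pairs: "(\<Sum>u\<in>UNIV. \<Sum>v\<in>UNIV. \<bar>y $ u - y $ v\<bar>) = 2 * (real (card T) * real (card (- T)))"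
    proof -
      have "(\<Sum>v\<in>UNIV. \<bar>y $ u - y $ v\<bar>) = (if u \<in> T then real (card (- T)) else real (card T))" for u
      proof (cases "u \<in> T")
        case True
        then have "\<bar>y $ u - y $ v\<bar> = indicator (- T) v" for v
          by (auto simp: y_nth split: split_indicator)
        then show ?thesis using True by (simp add: indicator_def Compl_eq)
      next
        case False
        then have "\<bar>y $ u - y $ v\<bar> = indicator T v" for v
          by (auto simp: y_nth split: split_indicator)
        then show ?thesis using False by (simp add: indicator_def)
      qed
      then show ?thesis
        by (simp add: sum.If_cases)
    qed
    have edges: "(\<Sum>e\<in>E. edge_diff y e) = real (card (cut E T))"
      by (simp add: y_def sum_edge_diff_two_valued[OF assms(1)])
    have "?\<rho> * (real (card T) * real (card (- T))) \<le> real (card (cut E T))"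
    \<comment> \<open>Minimality says nothing about trivial sets, but for them the left-hand side is
      zero.\<close>
    proof (cases "T = {} \<or> T = UNIV")
      case True
      then show ?thesis by auto
    next
      case False
      then have "0 < real (card T) * real (card (- T))"
        by (intro mult_pos_pos) (auto simp: card_gt_0_iff)
      moreover have "?\<rho> \<le> cut_density E T"
        using assms(2) False by (auto simp: sparsest_cut_def)
      ultimately show ?thesis
        by (simp add: cut_density_def[of E T] pos_le_divide_eq)
    qed
    then show ?thesis
      using split[of y] by (simp add: y_nth[symmetric] pairs edges)
  qed
  then have "0 \<le> (\<Sum>u\<in>UNIV. \<Sum>v\<in>UNIV. (of_bool ({u, v} \<in> E) - ?\<rho>) * \<bar>x $ u - x $ v\<bar>)"
    by (rule cut_inequality_extends)
  then show ?thesis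
    by (simp add: split)
qed

text \<open>For fixed \<open>u\<close>, mean zero turns the signed sum of
  \<open>x $ u - x $ v\<close> over all \<open>v\<close> into \<open>CARD('v) * x $ u\<close>; the
  triangle inequality does the rest.\<close>

lemma sum_pairwise_diff_ge:
  fixes x :: "real ^ 'v::finite"
  assumes "(\<Sum>v\<in>UNIV. x $ v) = 0"
  shows "real CARD('v) * (\<Sum>v\<in>UNIV. \<bar>x $ v\<bar>) \<le> (\<Sum>u\<in>UNIV. \<Sum>v\<in>UNIV. \<bar>x $ u - x $ v\<bar>)"
proof -
  have "real CARD('v) * \<bar>x $ u\<bar> \<le> (\<Sum>v\<in>UNIV. \<bar>x $ u - x $ v\<bar>)" for u
  proof -
    have "real CARD('v) * \<bar>x $ u\<bar> = \<bar>\<Sum>v\<in>UNIV. x $ u - x $ v\<bar>"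
      using assms by (simp add: sum_subtractf abs_mult)
    also have "\<dots> \<le> (\<Sum>v\<in>UNIV. \<bar>x $ u - x $ v\<bar>)"
      by (rule sum_abs)
    finally show ?thesis .
  qed
  then show ?thesis
    by (simp add: sum_distrib_left sum_mono)
qed

lemma l1_fiedler_value_eq_sparsest_cut:
  fixes E :: "'v::finite set set"
  assumes "simple_graph E" and "sparsest_cut E S"
  shows "l1_fiedler_value E =
    (1 / (2 * real (card S)) + 1 / (2 * real (card (- S)))) * real (card (cut E S))"
proof -
  let ?x = "l1_fiedler_vector S"
  let ?c = "1 / (2 * real (card S)) + 1 / (2 * real (card (- S)))"
  have ne: "S \<noteq> {}" "- S \<noteq> {}"
    using assms(2) by (auto simp: sparsest_cut_def)
  then have pos: "0 < card S" "0 < card (- S)"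
    by (simp_all add: card_gt_0_iff)
  have n: "real CARD('v) = real (card S) + real (card (- S))"
    using card_Un_disjoint[of S "- S"] by (simp add: Compl_partition)
  \<comment> \<open>With \<open>s + t\<close> the number of vertices and \<open>k\<close> the size
    of the cut, this identifies the value at the Fiedler vector with half the density times
    \<open>CARD('v)\<close>, the form in which the lower bound arises.\<close>
  have "(1 / (2 * s) + 1 / (2 * t)) * k = k / (s * t) * (s + t) / 2"
    if "0 < s" "0 < t" for s t k :: real
    using that by (simp add: field_simps)
  then have value_eq: "?c * real (card (cut E S)) = cut_density E S * real CARD('v) / 2"
    using pos by (simp only: cut_density_def n of_nat_0_less_iff)
  have edges: "(\<Sum>e\<in>E. edge_diff ?x e) = ?c * real (card (cut E S))"
    unfolding l1_fiedler_vector_def sum_edge_diff_two_valued[OF assms(1)] by simp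
  have mean: "(\<Sum>v\<in>UNIV. ?x $ v) = 0"
    using ne by (simp add: l1_fiedler_vector_def sum.If_cases)
  have norm: "(\<Sum>v\<in>UNIV. \<bar>?x $ v\<bar>) = 1"
    using ne by (simp add: l1_fiedler_vector_def if_distrib[of abs] sum.If_cases)
  show ?thesis
    unfolding l1_fiedler_value_def
  proof (rule Least_equality)
    show "?c * real (card (cut E S)) \<in> {(\<Sum>e\<in>E. edge_diff x e) | x :: real ^ 'v.
        (\<Sum>v\<in>UNIV. x $ v) = 0 \<and> (\<Sum>v\<in>UNIV. \<bar>x $ v\<bar>) = 1}"
      using edges mean norm by (auto intro!: exI[of _ ?x])
  next
    fix b
    assume "b \<in> {(\<Sum>e\<in>E. edge_diff x e) | x :: real ^ 'v.
        (\<Sum>v\<in>UNIV. x $ v) = 0 \<and> (\<Sum>v\<in>UNIV. \<bar>x $ v\<bar>) = 1}"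
    then obtain x :: "real ^ 'v" where b: "b = (\<Sum>e\<in>E. edge_diff x e)"
      and x: "(\<Sum>v\<in>UNIV. x $ v) = 0" "(\<Sum>v\<in>UNIV. \<bar>x $ v\<bar>) = 1"
      by auto
    have "cut_density E S * real CARD('v) \<le>
        cut_density E S * (\<Sum>u\<in>UNIV. \<Sum>v\<in>UNIV. \<bar>x $ u - x $ v\<bar>)"
      using sum_pairwise_diff_ge[OF x(1)] x(2)
      by (intro mult_left_mono) (simp_all add: cut_density_def)
    also have "\<dots> \<le> 2 * b"
      unfolding b by (rule sum_edge_diff_ge_density[OF assms])
    finally show "?c * real (card (cut E S)) \<le> b"
      by (simp add: value_eq)
  qed
qed

section \<open>The Laplacian on two-valued vectors\<close>

lemma degree_eq_sum:
  fixes E :: "'v::finite set set"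
  assumes "simple_graph E"
  shows "real (degree E u) = (\<Sum>v\<in>UNIV. of_bool ({u, v} \<in> E))"
proof -
  have "bij_betw (\<lambda>v. {u, v}) {v. {u, v} \<in> E} {e \<in> E. u \<in> e}"
  proof (rule bij_betw_imageI)
    show "inj_on (\<lambda>v. {u, v}) {v. {u, v} \<in> E}"
      by (auto simp: inj_on_def doubleton_eq_iff)
    have "\<exists>v. e = {u, v}" if "e \<in> E" "u \<in> e" for e
      using simple_graph_edgeE[OF assms \<open>e \<in> E\<close>] \<open>u \<in> e\<close> by (metis insertE insert_commute singletonD)
    then show "(\<lambda>v. {u, v}) ` {v. {u, v} \<in> E} = {e \<in> E. u \<in> e}"
      by blast
  qed
  then have "degree E u = card {v. {u, v} \<in> E}"
    by (simp add: degree_def bij_betw_same_card)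
  then show ?thesis
    by (simp add: of_bool_def sum.If_cases)
qed

text \<open>Writing the degree as a sum over neighbours merges diagonal and adjacency terms into
  differences, which vanish between vertices of equal value.\<close>

lemma laplacian_mult_vec_nth:
  fixes E :: "'v::finite set set"
  assumes "simple_graph E"
  shows "(laplacian E *v x) $ u = (\<Sum>v\<in>UNIV. of_bool ({u, v} \<in> E) * (x $ u - x $ v))"
proof -
  have "(laplacian E *v x) $ u =
      (\<Sum>v\<in>UNIV. (if u = v then real (degree E u) else 0) * x $ v) -
      (\<Sum>v\<in>UNIV. of_bool ({u, v} \<in> E) * x $ v)"
    by (simp add: laplacian_def degree_matrix_def adjacency_matrix_def matrix_vector_mult_def
        left_diff_distrib sum_subtractf of_bool_def)
  also have "(\<Sum>v\<in>UNIV. (if u = v then real (degree E u) else 0) * x $ v) = real (degree E u) * x $ u"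
    by (simp add: if_distrib[of "\<lambda>c. c * _"] cong: if_cong)
  finally show ?thesis
    by (simp add: degree_eq_sum[OF assms] sum_distrib_right right_diff_distrib sum_subtractf)
qed

text \<open>Within \<open>T\<close> all differences are zero, so each \<open>u\<close> in
  \<open>T\<close> contributes \<open>a - b\<close> once for every edge leaving \<open>T\<close> at
  \<open>u\<close>.\<close>

lemma sum_laplacian_two_valued:
  fixes E :: "'v::finite set set"
  assumes "simple_graph E" and "\<And>v. v \<in> T \<Longrightarrow> x $ v = a" and "\<And>v. v \<notin> T \<Longrightarrow> x $ v = b"
  shows "(\<Sum>u\<in>T. (laplacian E *v x) $ u) = (a - b) * real (card (cut E T))"
proof -
  have "(laplacian E *v x) $ u = (a - b) * (\<Sum>v\<in>- T. of_bool ({u, v} \<in> E))" if "u \<in> T" for u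
    unfolding laplacian_mult_vec_nth[OF assms(1)] sum_distrib_left
    using that assms(2,3) by (intro sum.mono_neutral_cong_right) auto
  then show ?thesis
    by (simp add: card_cut_eq_sum sum_distrib_left)
qed

theorem theorem5p1:
  fixes E :: "'v::finite set set" and S :: "'v set" and x :: "real ^ 'v"
  assumes "CARD('v) \<ge> 2"
    and "simple_graph E"
    and "sparsest_cut E S"
    and "x = l1_fiedler_vector S"
  shows "(\<Sum>u\<in>S. (laplacian E *v x) $ u) = l1_fiedler_value E \<and>
         (\<Sum>u\<in>- S. (laplacian E *v x) $ u) = - l1_fiedler_value E"
proof -
  let ?a = "1 / (2 * real (card S))" and ?b = "- (1 / (2 * real (card (- S))))"
  have "(\<Sum>u\<in>S. (laplacian E *v x) $ u) = (?a - ?b) * real (card (cut E S))"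
    by (rule sum_laplacian_two_valued[OF assms(2)])
      (simp_all add: assms(4) l1_fiedler_vector_def)
  \<comment> \<open>On the complement the two values trade places, which flips the sign, while the
    cut stays the same.\<close>
  moreover have "(\<Sum>u\<in>- S. (laplacian E *v x) $ u) = (?b - ?a) * real (card (cut E (- S)))"
    by (rule sum_laplacian_two_valued[OF assms(2)])
      (simp_all add: assms(4) l1_fiedler_vector_def)
  ultimately show ?thesis
    by (simp add: l1_fiedler_value_eq_sparsest_cut[OF assms(2,3)] cut_Compl algebra_simps)
qed

end
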